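(* For every constant $C>0$ there exists a constant $C'<\infty$ such that the following holds. For every integer $n\ge 1$, every $p,s\in(0,1)$ (with $q=ps$ and $\rho=\frac{s(1-p)}{1-ps}$), and every integer $d$ with $1\le d\le C\rho^{-1}$, \[ \sup_{f\in\mathcal P_{n,d},\ \mathbb E_{\mathbb Q}[f^2]>0}\frac{\mathbb E_{\mathbb P}[f(A,B)]}{\sqrt{\mathbb E_{\mathbb Q}[f(A,B)^2]}}\le C'. \]
   Context: Correlated Erdős–Rényi model: for an integer $n\ge1$ let $\operatorname{U}_n$ be the set of unordered pairs $\{i,j\}$, $i\ne j$, of $[n]=\{1,\dots,n\}$. Given $p,s\in(0,1)$, let $(I_{i,j})_{\{i,j\}\in\operatorname{U}_n}$ be i.i.d. Bernoulli$(p)$, $(J_{i,j})$ and $(K_{i,j})$ i.i.d. Bernoulli$(s)$, and $\pi_*$ a uniformly random permutation of $[n]$, all independent. Define graphs on $[n]$ (identified with their adjacency vectors in $\{0,1\}^{\operatorname{U}_n}$) by $G_{i,j}=I_{i,j}$, $A_{i,j}=I_{i,j}J_{i,j}$, $B_{\pi_*(i),\pi_*(j)}=I_{i,j}K_{i,j}$. Set $q=ps$ and $\rho=\frac{s(1-p)}{1-ps}$. Let $\mathbb P$ be the law of $(A,B)$, and $\mathbb Q$ the law of a pair $(A,B)$ of independent Erdős–Rényi graphs on $[n]$ with edge density $q$. $\mathcal P_{n,d}$ denotes the set of real polynomials of degree at most $d$ in the $2|\operatorname{U}_n|$ variables $(A_e)_{e\in\operatorname{U}_n},(B_e)_{e\in\operatorname{U}_n}$,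 viewed as functions on $\{0,1\}^{2|\operatorname{U}_n|}$. *)

theory Defs
  imports "HOL-Probability.Probability" "HOL-Combinatorics.Permutations" "HOL-Library.Multiset"
begin

definition edge_slots :: "nat \<Rightarrow> nat set set" where
  "edge_slots n = {{i, j} | i j. i \<in> {1..n} \<and> j \<in> {1..n} \<and> i \<noteq> j}"

text \<open>A graph on \<open>{1..n}\<close> is identified with its adjacency vector indexed by
  \<^term>\<open>edge_slots n\<close>; outside this index set the value is \<^term>\<open>False\<close>.\<close>

type_synonym adjacency = "nat set \<Rightarrow> bool"

definition bernoulli_field :: "nat \<Rightarrow> real \<Rightarrow> adjacency pmf" where
  "bernoulli_field n r = Pi_pmf (edge_slots n) False (\<lambda>_. bernoulli_pmf r)"

text \<open>The graph \<open>B\<close> determined by \<open>B (\<pi> ` e) = H e\<close>; see \<open>relabel_image\<close> below.\<close>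

definition relabel :: "(nat \<Rightarrow> nat) \<Rightarrow> adjacency \<Rightarrow> adjacency" where
  "relabel \<pi> H = (\<lambda>e. H (inv \<pi> ` e))"

definition correlated_law :: "nat \<Rightarrow> real \<Rightarrow> real \<Rightarrow> (adjacency \<times> adjacency) pmf" where
  "correlated_law n p s =
     do {
       I \<leftarrow> bernoulli_field n p;
       J \<leftarrow> bernoulli_field n s;
       K \<leftarrow> bernoulli_field n s;
       \<pi> \<leftarrow> pmf_of_set {\<pi>. \<pi> permutes {1..n}};
       return_pmf (\<lambda>e. I e \<and> J e, relabel \<pi> (\<lambda>e. I e \<and> K e))
     }"

definition independent_law :: "nat \<Rightarrow> real \<Rightarrow> (adjacency \<times> adjacency) pmf" where
  "independent_law n q = pair_pmf (bernoulli_field n q) (bernoulli_field n q)"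

text \<open>The variable \<open>A\<^sub>e\<close> is encoded as \<^term>\<open>Inl e\<close> and \<open>B\<^sub>e\<close> as \<^term>\<open>Inr e\<close>.
  A monomial is the multiset of its variables, so its degree is the size of the multiset.\<close>

fun var_value :: "adjacency \<times> adjacency \<Rightarrow> nat set + nat set \<Rightarrow> real" where
  "var_value (A, B) (Inl e) = of_bool (A e)"
| "var_value (A, B) (Inr e) = of_bool (B e)"

definition monomials :: "nat \<Rightarrow> nat \<Rightarrow> (nat set + nat set) multiset set" where
  "monomials n d = {m. set_mset m \<subseteq> edge_slots n <+> edge_slots n \<and> size m \<le> d}"

definition poly_functions :: "nat \<Rightarrow> nat \<Rightarrow> (adjacency \<times> adjacency \<Rightarrow> real) set" where
  "poly_functions n d =
     {f. \<exists>c. \<forall>G. f G = (\<Sum>m\<in>monomials n d. c m * (\<Prod>v\<in>#m. var_value G v))}"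

lemma relabel_image:
  assumes "\<pi> permutes {1..n}"
  shows "relabel \<pi> H (\<pi> ` e) = H e"
  using permutes_inj[OF assms] by (simp add: relabel_def image_comp comp_def)

lemma finite_edge_slots: "finite (edge_slots n)"
  by (rule finite_subset[of _ "Pow {1..n}"]) (auto simp: edge_slots_def)

lemma finite_monomials: "finite (monomials n d)"
proof (rule finite_subset)
  show "monomials n d \<subseteq>
    mset ` {xs. set xs \<subseteq> edge_slots n <+> edge_slots n \<and> length xs \<le> d}"
  proof
    fix m assume m: "m \<in> monomials n d"
    obtain xs where "m = mset xs" using ex_mset by metis
    with m show "m \<in> mset ` {xs. set xs \<subseteq> edge_slots n <+> edge_slots n \<and> length xs \<le> d}"
      by (auto simp: monomials_def)
  qed
  show "finite (mset ` {xs. set xs \<subseteq> edge_slots n <+> edge_slots n \<and> length xs \<le> d})"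
    by (intro finite_imageI finite_lists_length_le finite_Plus finite_edge_slots)
qed

end

theory Submission imports Defs begin

text \<open>The products of centered edge variables form an orthogonal basis of the polynomials under the
  independent law. Under the correlated law the normalised basis element with edge sets \<open>S\<close> in
  the first graph and \<open>T\<close> in the second has mean \<open>\<rho>\<^bsup>|S|\<^esup> P(\<pi> S = T)\<close>. By Cauchy-Schwarz the squared
  advantage is at most the sum of the squares of these means over \<open>|S| + |T| \<le> d\<close>. Since
  \<open>P(\<pi> S = T)\<close> is the inverse of the size of the orbit of \<open>S\<close> when \<open>T\<close> lies in it, this is the sum
  over \<open>k \<le> d / 2\<close> of \<open>\<rho>\<^bsup>2k\<^esup>\<close> times the number of isomorphism classes of graphs with \<open>k\<close> edges.
  There are at most \<open>(2k)\<^bsup>2k\<^esup> / k!\<close> such classes, and \<open>2k\<rho> \<le> d\<rho> \<le> C\<close>, so the sum is at most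
  \<open>exp (C\<^sup>2)\<close>.\<close>

section \<open>Expectations of products\<close>

lemma expectation_bind_pmf_finite:
  fixes h :: "'b \<Rightarrow> real"
  assumes "finite (set_pmf p)" "\<And>x. x \<in> set_pmf p \<Longrightarrow> finite (set_pmf (f x))"
  shows "measure_pmf.expectation (bind_pmf p f) h =
         measure_pmf.expectation p (\<lambda>x. measure_pmf.expectation (f x) h)"
  using assms
  by (subst pmf_expectation_bind[of "set_pmf p"])
     (auto simp: integral_measure_pmf_real[of "set_pmf p"] mult.commute)

lemma expectation_pair_pmf_finite:
  fixes h :: "'a \<times> 'b \<Rightarrow> real"
  assumes "finite (set_pmf p)" "finite (set_pmf q)"
  shows "measure_pmf.expectation (pair_pmf p q) h =
         measure_pmf.expectation p (\<lambda>x. measure_pmf.expectation q (\<lambda>y. h (x, y)))"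
  unfolding pair_pmf_def using assms by (simp add: expectation_bind_pmf_finite)

lemma finite_set_Pi_pmf:
  assumes "finite A" "\<And>x. x \<in> A \<Longrightarrow> finite (set_pmf (p x))"
  shows "finite (set_pmf (Pi_pmf A dflt p))"
  using assms by (simp add: set_Pi_pmf finite_PiE_dflt)

lemma expectation_prod_Pi_pmf_finite:
  fixes f :: "'a \<Rightarrow> 'b \<Rightarrow> real"
  assumes "finite A" "\<And>x. x \<in> A \<Longrightarrow> finite (set_pmf (p x))"
  shows "measure_pmf.expectation (Pi_pmf A dflt p) (\<lambda>y. \<Prod>x\<in>A. f x (y x)) =
         (\<Prod>x\<in>A. measure_pmf.expectation (p x) (f x))"
  using assms
proof (induction A rule: finite_induct)
  case (insert a A)
  have "(\<Prod>x\<in>A. f x ((g(a := y)) x)) = (\<Prod>x\<in>A. f x (g x))" for g y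
    using insert.hyps by (intro prod.cong) auto
  then show ?case
    using insert
    by (simp add: Pi_pmf_insert case_prod_unfold expectation_pair_pmf_finite finite_set_Pi_pmf)
qed simp

lemma finite_set_bernoulli_field: "finite (set_pmf (bernoulli_field n r))"
  unfolding bernoulli_field_def
  by (simp add: finite_set_Pi_pmf finite_edge_slots)

lemma expectation_bernoulli_field_prod:
  fixes f :: "nat set \<Rightarrow> bool \<Rightarrow> real"
  assumes "0 \<le> r" "r \<le> 1"
  shows "measure_pmf.expectation (bernoulli_field n r) (\<lambda>H. \<Prod>e\<in>edge_slots n. f e (H e)) =
         (\<Prod>e\<in>edge_slots n. f e True * r + f e False * (1 - r))"
  unfolding bernoulli_field_def using assms finite_edge_slots
  by (subst expectation_prod_Pi_pmf_finite) auto

text \<open>Both moment computations factor over edges into this pattern. An edge in both sets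
  contributes a variance or covariance \<open>a\<close>, an edge in exactly one contributes a
  centered mean, which vanishes, and an edge in neither contributes 1. One vanishing factor is
  enough to make the product 0.\<close>

lemma prod_both_or_neither:
  fixes a :: real
  assumes "finite U" "S \<subseteq> U" "T \<subseteq> U"
  shows "(\<Prod>e\<in>U. if e \<in> S \<and> e \<in> T then a else if e \<in> S \<or> e \<in> T then 0 else 1) =
         (if S = T then a ^ card S else 0)"
proof (cases "S = T")
  case True
  have "(\<Prod>e\<in>U. if e \<in> S then a else 1) = (\<Prod>e\<in>S. a)"
    using assms by (simp add: prod.If_cases Int_absorb1)
  then show ?thesis using True by (simp cong: if_cong)
next
  case False
  then obtain e where "e \<in> U" "e \<in> S \<longleftrightarrow> e \<notin> T" using assms by blast
  then show ?thesis using False \<open>finite U\<close> by (auto intro!: prod_zero bexI[of _ e])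
qed

section \<open>The centered monomial basis\<close>

text \<open>The basis element is left unnormalised. Its norm under the independent law is a power of
  \<open>sqrt (q * (1 - q))\<close>, which is moved into the coefficients in the final
  estimate.\<close>

definition centered :: "real \<Rightarrow> (nat set + nat set) set \<Rightarrow> adjacency \<times> adjacency \<Rightarrow> real" where
  "centered q X G = (\<Prod>v\<in>X. var_value G v - q)"

text \<open>One subset of the disjoint sum encodes the pair of edge sets: \<open>Inl -\<close>
  X\<open>lies in the first graph and\<close>Inr -\<open>X\<close> in the second. Sets suffice in
  place of multisets because the variables are 0/1-valued.\<close>

definition index_sets :: "nat \<Rightarrow> nat \<Rightarrow> (nat set + nat set) set set" where
  "index_sets n d = {X. X \<subseteq> edge_slots n <+> edge_slots n \<and> card X \<le> d}"

lemma finite_index_sets: "finite (index_sets n d)"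
  by (rule finite_subset[of _ "Pow (edge_slots n <+> edge_slots n)"])
     (auto simp: index_sets_def finite_edge_slots)

lemma finite_in_index_sets: "X \<in> index_sets n d \<Longrightarrow> finite X"
  unfolding index_sets_def by (auto intro: finite_subset simp: finite_edge_slots)

text \<open>Padding with factors 1 lets both products run over all edge slots, which is the shape to
  which independence of the edges applies.\<close>

lemma centered_eq_prod:
  assumes "X \<subseteq> edge_slots n <+> edge_slots n"
  shows "centered q X (A, B) =
    (\<Prod>e\<in>edge_slots n. if Inl e \<in> X then of_bool (A e) - q else 1) *
    (\<Prod>e\<in>edge_slots n. if Inr e \<in> X then of_bool (B e) - q else 1)"
proof -
  have "centered q X (A, B) =
      (\<Prod>v\<in>edge_slots n <+> edge_slots n. if v \<in> X then var_value (A, B) v - q else 1)"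
    unfolding centered_def using assms
    by (subst prod.inter_restrict[symmetric]) (auto simp: finite_edge_slots Int_absorb1)
  then show ?thesis
    by (simp add: prod.Plus finite_edge_slots cong: if_cong)
qed

section \<open>Change of basis from monomials to centered products\<close>

definition centered_span :: "nat \<Rightarrow> real \<Rightarrow> nat \<Rightarrow> (adjacency \<times> adjacency \<Rightarrow> real) set" where
  "centered_span n q d = {f. \<exists>c. \<forall>G. f G = (\<Sum>X\<in>index_sets n d. c X * centered q X G)}"

lemma centered_span_centered:
  assumes "X \<in> index_sets n d"
  shows "centered q X \<in> centered_span n q d"
  unfolding centered_span_def
  by (auto intro!: exI[of _ "\<lambda>Y. of_bool (Y = X)"] simp: finite_index_sets assms of_bool_def
      if_distrib[of "\<lambda>x. x * _"] sum.delta cong: if_cong)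

lemma centered_span_add:
  assumes "f \<in> centered_span n q d" "g \<in> centered_span n q d"
  shows "(\<lambda>G. f G + g G) \<in> centered_span n q d"
proof -
  obtain c c' where "\<forall>G. f G = (\<Sum>X\<in>index_sets n d. c X * centered q X G)"
    "\<forall>G. g G = (\<Sum>X\<in>index_sets n d. c' X * centered q X G)"
    using assms by (auto simp: centered_span_def)
  then show ?thesis unfolding centered_span_def
    by (auto intro!: exI[of _ "\<lambda>X. c X + c' X"] simp: sum.distrib distrib_right)
qed

lemma centered_span_scale:
  assumes "f \<in> centered_span n q d"
  shows "(\<lambda>G. a * f G) \<in> centered_span n q d"
proof -
  obtain c where "\<forall>G. f G = (\<Sum>X\<in>index_sets n d. c X * centered q X G)"
    using assms by (auto simp: centered_span_def)
  then show ?thesis unfolding centered_span_def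
    by (auto intro!: exI[of _ "\<lambda>X. a * c X"] simp: sum_distrib_left mult.assoc)
qed

lemma centered_span_sum:
  assumes "\<And>i. i \<in> I \<Longrightarrow> f i \<in> centered_span n q d"
  shows "(\<lambda>G. \<Sum>i\<in>I. f i G) \<in> centered_span n q d"
  using assms
proof (induction I rule: infinite_finite_induct)
  case (insert i I)
  then show ?case using centered_span_add[of "f i" n q d "\<lambda>G. \<Sum>i\<in>I. f i G"] by simp
qed (auto simp: centered_span_def intro!: exI[of _ "\<lambda>_. 0"])

lemma var_value_square: "var_value G v * var_value G v = var_value G v"
  by (cases G; cases v) auto

text \<open>Write x for the value of \<open>v\<close>. If \<open>v\<close> is in \<open>X\<close>,
  then x * x = x gives x * (x - q) = (1 - q) * (x - q) + q * (1 - q), so no new variable appears.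
  Otherwise x = (x - q) + q, which adds the single variable \<open>v\<close>.\<close>

lemma var_value_mult_centered:
  assumes X: "X \<in> index_sets n d" and v: "v \<in> edge_slots n <+> edge_slots n"
  shows "(\<lambda>G. var_value G v * centered q X G) \<in> centered_span n q (Suc d)"
proof -
  have fin: "finite X" using X by (rule finite_in_index_sets)
  have X': "X \<in> index_sets n (Suc d)" using X by (auto simp: index_sets_def)
  show ?thesis
  proof (cases "v \<in> X")
    case True
    have "X - {v} \<in> index_sets n (Suc d)"
      using X fin card_Diff1_le[of X v] by (auto simp: index_sets_def)
    then have "(\<lambda>G. (1 - q) * centered q X G + (q * (1 - q)) * centered q (X - {v}) G)
        \<in> centered_span n q (Suc d)"
      by (intro centered_span_add centered_span_scale centered_span_centered X')
    moreover have "var_value G v * centered q X G =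
        (1 - q) * centered q X G + (q * (1 - q)) * centered q (X - {v}) G" for G
    proof -
      have eq: "centered q X G = (var_value G v - q) * centered q (X - {v}) G"
        unfolding centered_def using fin True by (rule prod.remove)
      have "var_value G v * (var_value G v - q) = (1 - q) * (var_value G v - q) + q * (1 - q)"
        using var_value_square[of G v] by (simp add: algebra_simps)
      then have "var_value G v * (var_value G v - q) * centered q (X - {v}) G =
        ((1 - q) * (var_value G v - q) + q * (1 - q)) * centered q (X - {v}) G"
        by simp
      then show ?thesis by (simp add: eq algebra_simps)
    qed
    ultimately show ?thesis by simp
  next
    case False
    have "insert v X \<in> index_sets n (Suc d)"
      using X v fin False by (auto simp: index_sets_def)
    then have "(\<lambda>G. centered q (insert v X) G + q * centered q X G) \<in> centered_span n q (Suc d)"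
      by (intro centered_span_add centered_span_scale centered_span_centered X')
    moreover have "var_value G v * centered q X G =
        centered q (insert v X) G + q * centered q X G" for G
      unfolding centered_def using fin False by (simp add: algebra_simps)
    ultimately show ?thesis by simp
  qed
qed

lemma centered_span_var_value_mult:
  assumes f: "f \<in> centered_span n q d" and v: "v \<in> edge_slots n <+> edge_slots n"
  shows "(\<lambda>G. var_value G v * f G) \<in> centered_span n q (Suc d)"
proof -
  obtain c where c: "\<And>G. f G = (\<Sum>X\<in>index_sets n d. c X * centered q X G)"
    using f by (auto simp: centered_span_def)
  have "(\<lambda>G. \<Sum>X\<in>index_sets n d. c X * (var_value G v * centered q X G))
      \<in> centered_span n q (Suc d)"
    by (intro centered_span_sum centered_span_scale var_value_mult_centered v)
  then show ?thesis by (simp add: c sum_distrib_left mult.left_commute)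
qed

lemma centered_span_mono:
  assumes f: "f \<in> centered_span n q d" and "d \<le> d'"
  shows "f \<in> centered_span n q d'"
proof -
  obtain c where c: "\<And>G. f G = (\<Sum>X\<in>index_sets n d. c X * centered q X G)"
    using f by (auto simp: centered_span_def)
  have "index_sets n d \<subseteq> index_sets n d'" using assms(2) by (auto simp: index_sets_def)
  then have "(\<lambda>G. \<Sum>X\<in>index_sets n d. c X * centered q X G) \<in> centered_span n q d'"
    by (intro centered_span_sum centered_span_scale centered_span_centered) auto
  then show ?thesis by (simp add: c[abs_def])
qed

text \<open>The monomial is built one variable at a time. Each factor raises the degree bound by
  one, repeated variables included, in agreement with \<open>size\<close>, which counts
  multiplicities.\<close>

lemma centered_span_monomial:
  assumes "set_mset m \<subseteq> edge_slots n <+> edge_slots n"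
  shows "(\<lambda>G. \<Prod>v\<in>#m. var_value G v) \<in> centered_span n q (size m)"
  using assms
proof (induction m)
  case empty
  show ?case
    using centered_span_centered[of "{}" n 0 q] by (simp add: centered_def[abs_def] index_sets_def)
next
  case (add v m)
  then show ?case using centered_span_var_value_mult[of _ n q "size m" v] by simp
qed

lemma poly_functions_subset_centered_span: "poly_functions n d \<subseteq> centered_span n q d"
proof
  fix f assume "f \<in> poly_functions n d"
  then obtain c where c: "\<And>G. f G = (\<Sum>m\<in>monomials n d. c m * (\<Prod>v\<in>#m. var_value G v))"
    by (auto simp: poly_functions_def)
  have "(\<lambda>G. \<Sum>m\<in>monomials n d. c m * (\<Prod>v\<in>#m. var_value G v)) \<in> centered_span n q d"
    by (intro centered_span_sum centered_span_scale centered_span_mono[OF centered_span_monomial])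
       (auto simp: monomials_def)
  then show "f \<in> centered_span n q d" by (simp add: c[abs_def])
qed

section \<open>Moments of the centered monomials\<close>

lemma finite_set_independent_law: "finite (set_pmf (independent_law n q))"
  by (simp add: independent_law_def finite_set_bernoulli_field)

lemma expectation_independent_centered_mult:
  assumes q: "0 \<le> q" "q \<le> 1"
    and X: "X \<subseteq> edge_slots n <+> edge_slots n" and Y: "Y \<subseteq> edge_slots n <+> edge_slots n"
  shows "measure_pmf.expectation (independent_law n q) (\<lambda>G. centered q X G * centered q Y G) =
         (if X = Y then (q * (1 - q)) ^ card X else 0)"
proof -
  \<comment> \<open>The argument \<open>i\<close> is later \<open>Inl\<close> or \<open>Inr\<close>,
    so that one per-edge factor serves both graphs.\<close>
  define g where "g = (\<lambda>i (e::nat set) b.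
    (if i e \<in> X then of_bool b - q else 1) * (if i e \<in> Y then of_bool b - q else 1))"
  let ?h = "\<lambda>v. if v \<in> X \<and> v \<in> Y then q * (1 - q) else if v \<in> X \<or> v \<in> Y then 0 else 1"
  have mean: "g i e True * q + g i e False * (1 - q) = ?h (i e)" for i :: "nat set \<Rightarrow> _" and e
    by (auto simp: g_def algebra_simps)
  have "measure_pmf.expectation (independent_law n q) (\<lambda>G. centered q X G * centered q Y G) =
    measure_pmf.expectation (bernoulli_field n q) (\<lambda>A. measure_pmf.expectation (bernoulli_field n q)
      (\<lambda>B. (\<Prod>e\<in>edge_slots n. g Inl e (A e)) * (\<Prod>e\<in>edge_slots n. g Inr e (B e))))"
    unfolding independent_law_def
    by (simp only: expectation_pair_pmf_finite finite_set_bernoulli_field centered_eq_prod[OF X]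
        centered_eq_prod[OF Y] g_def prod.distrib mult_ac)
  also have "\<dots> = (\<Prod>e\<in>edge_slots n. ?h (Inl e)) * (\<Prod>e\<in>edge_slots n. ?h (Inr e))"
    by (simp only: integral_mult_right_zero integral_mult_left_zero
        expectation_bernoulli_field_prod[OF q, where f = "g Inl"]
        expectation_bernoulli_field_prod[OF q, where f = "g Inr"] mean)
  also have "\<dots> = (\<Prod>v\<in>edge_slots n <+> edge_slots n. ?h v)"
    by (simp add: prod.Plus finite_edge_slots)
  also have "\<dots> = (if X = Y then (q * (1 - q)) ^ card X else 0)"
    using X Y by (intro prod_both_or_neither) (auto simp: finite_edge_slots)
  finally show ?thesis .
qed

section \<open>First moments under the correlated law\<close>

lemma bij_betw_image_edge_slots:
  assumes "\<pi> permutes {1..n}"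
  shows "bij_betw ((`) \<pi>) (edge_slots n) (edge_slots n)"
proof -
  have sub: "(`) \<sigma> ` edge_slots n \<subseteq> edge_slots n" if "\<sigma> permutes {1..n}" for \<sigma>
  proof
    fix x assume "x \<in> (`) \<sigma> ` edge_slots n"
    then obtain i j where "i \<in> {1..n}" "j \<in> {1..n}" "i \<noteq> j" "x = {\<sigma> i, \<sigma> j}"
      by (auto simp: edge_slots_def)
    moreover have "\<sigma> i \<noteq> \<sigma> j" using permutes_inj[OF that] \<open>i \<noteq> j\<close> by (auto dest: injD)
    ultimately show "x \<in> edge_slots n"
      using permutes_in_image[OF that] unfolding edge_slots_def by blast
  qed
  show ?thesis
    by (rule bij_betwI[where g = "(`) (inv \<pi>)"])
       (use sub[OF assms] sub[OF permutes_inv[OF assms]] in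
        \<open>auto simp: image_comp permutes_inv_o[OF assms]\<close>)
qed

text \<open>For a fixed permutation the triples (I e, J e, K e) are independent over
  \<open>e\<close>, so the expectation factors. The base of the power is the covariance of I J and I
  K on one edge, p s^2 - (p s)^2 = p s^2 (1 - p).\<close>

lemma expectation_correlated_centered_given_permutation:
  assumes p: "0 \<le> p" "p \<le> 1" and s: "0 \<le> s" "s \<le> 1"
    and X: "X \<subseteq> edge_slots n <+> edge_slots n" and \<pi>: "\<pi> permutes {1..n}"
  shows "measure_pmf.expectation (bernoulli_field n p) (\<lambda>I.
           measure_pmf.expectation (bernoulli_field n s) (\<lambda>J.
             measure_pmf.expectation (bernoulli_field n s) (\<lambda>K.
               centered (p * s) X (\<lambda>e. I e \<and> J e, relabel \<pi> (\<lambda>e. I e \<and> K e))))) =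
         (if (`) \<pi> ` (Inl -` X) = Inr -` X then (p * s\<^sup>2 * (1 - p)) ^ card (Inl -` X) else 0)"
proof -
  define q where "q = p * s"
  define g where "g = (\<lambda>e a j k. (if Inl e \<in> X then of_bool (a \<and> j) - q else 1) *
      (if Inr (\<pi> ` e) \<in> X then of_bool (a \<and> k) - q else (1::real)))"
  \<comment> \<open>\<open>?T\<close> is the second edge set pulled back along the permutation, so
    that both sets live on the edges of the parent graph.\<close>
  let ?S = "Inl -` X" and ?T = "{e \<in> edge_slots n. Inr (\<pi> ` e) \<in> X}"
  have bij: "bij_betw ((`) \<pi>) (edge_slots n) (edge_slots n)"
    by (rule bij_betw_image_edge_slots[OF \<pi>])
  \<comment> \<open>Reindexing the second product by the action of the permutation on edges makes
    both factors at \<open>e\<close> depend only on I, J, K at \<open>e\<close>.\<close>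
  have eq: "centered q X (\<lambda>e. I e \<and> J e, relabel \<pi> (\<lambda>e. I e \<and> K e)) =
      (\<Prod>e\<in>edge_slots n. g e (I e) (J e) (K e))" for I J K
    unfolding centered_eq_prod[OF X] g_def prod.distrib
    by (subst (2) prod.reindex_bij_betw[OF bij, symmetric]) (simp add: relabel_image[OF \<pi>] cong: if_cong)
  \<comment> \<open>The left side averages one edge factor over K, then J, then I, in the order in
    which the three expectations are evaluated below.\<close>
  have mean: "(((g e True True True * s + g e True True False * (1 - s)) * s +
       (g e True False True * s + g e True False False * (1 - s)) * (1 - s)) * p +
      ((g e False True True * s + g e False True False * (1 - s)) * s +
       (g e False False True * s + g e False False False * (1 - s)) * (1 - s)) * (1 - p)) =
     (if e \<in> ?S \<and> e \<in> ?T then p * s\<^sup>2 * (1 - p) else if e \<in> ?S \<or> e \<in> ?T then 0 else 1)"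
    if "e \<in> edge_slots n" for e
    using that by (simp add: g_def q_def, algebra)
  have "measure_pmf.expectation (bernoulli_field n p) (\<lambda>I.
           measure_pmf.expectation (bernoulli_field n s) (\<lambda>J.
             measure_pmf.expectation (bernoulli_field n s) (\<lambda>K.
               centered q X (\<lambda>e. I e \<and> J e, relabel \<pi> (\<lambda>e. I e \<and> K e))))) =
    (\<Prod>e\<in>edge_slots n.
      if e \<in> ?S \<and> e \<in> ?T then p * s\<^sup>2 * (1 - p) else if e \<in> ?S \<or> e \<in> ?T then 0 else 1)"
    unfolding eq
      expectation_bernoulli_field_prod[OF s, where f = "\<lambda>e. g e (I e) (J e)" for I J]
      expectation_bernoulli_field_prod[OF s, where f =
        "\<lambda>e j. g e (I e) j True * s + g e (I e) j False * (1 - s)" for I]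
      expectation_bernoulli_field_prod[OF p, where f =
        "\<lambda>e a. (g e a True True * s + g e a True False * (1 - s)) * s +
               (g e a False True * s + g e a False False * (1 - s)) * (1 - s)"]
    by (intro prod.cong refl mean)
  also have "\<dots> = (if ?S = ?T then (p * s\<^sup>2 * (1 - p)) ^ card ?S else 0)"
    using X by (intro prod_both_or_neither) (auto simp: finite_edge_slots)
  also have "?S = ?T \<longleftrightarrow> (`) \<pi> ` ?S = Inr -` X"
  proof -
    have S: "?S \<subseteq> edge_slots n" and T: "Inr -` X \<subseteq> edge_slots n" using X by auto
    have "(`) \<pi> ` ?T = Inr -` X"
    proof
      show "Inr -` X \<subseteq> (`) \<pi> ` ?T"
      proof
        fix x assume x: "x \<in> Inr -` X"
        then have "x \<in> (`) \<pi> ` edge_slots n" using T bij by (auto simp: bij_betw_def)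
        then show "x \<in> (`) \<pi> ` ?T" using x by auto
      qed
    qed auto
    moreover have "(`) \<pi> ` ?S = (`) \<pi> ` ?T \<longleftrightarrow> ?S = ?T"
      using S bij by (intro inj_on_image_eq_iff[of _ "edge_slots n"]) (auto simp: bij_betw_def)
    ultimately show ?thesis by simp
  qed
  finally show ?thesis by (simp only: q_def)
qed

definition match_prob :: "nat \<Rightarrow> nat set set \<Rightarrow> nat set set \<Rightarrow> real" where
  "match_prob n S T = real (card {\<pi>. \<pi> permutes {1..n} \<and> (`) \<pi> ` S = T}) / fact n"

text \<open>The permutation, drawn last in \<open>correlated_law\<close>, becomes the outermost
  average. This is legitimate since all sums are finite, and it allows the computation for a fixed
  permutation to be applied term by term.\<close>

lemma expectation_correlated_law:
  fixes f :: "adjacency \<times> adjacency \<Rightarrow> real"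
  shows "measure_pmf.expectation (correlated_law n p s) f =
    (\<Sum>\<pi> | \<pi> permutes {1..n}.
        measure_pmf.expectation (bernoulli_field n p) (\<lambda>I.
           measure_pmf.expectation (bernoulli_field n s) (\<lambda>J.
             measure_pmf.expectation (bernoulli_field n s) (\<lambda>K.
               f (\<lambda>e. I e \<and> J e, relabel \<pi> (\<lambda>e. I e \<and> K e)))))) / fact n"
proof -
  define P where "P = {\<pi>. \<pi> permutes {1..n}}"
  have fin: "finite P" by (simp add: P_def finite_permutations)
  have ne: "P \<noteq> {}" using permutes_id[of "{1..n}"] unfolding P_def by blast
  have card: "card P = fact n" by (simp add: P_def card_permutations)
  show ?thesis
    unfolding correlated_law_def P_def[symmetric]
    by (simp add: expectation_bind_pmf_finite finite_set_bernoulli_field fin ne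
        integral_pmf_of_set card Bochner_Integration.integral_sum integrable_measure_pmf_finite)
qed

lemma finite_set_correlated_law: "finite (set_pmf (correlated_law n p s))"
proof -
  have "finite {\<pi>. \<pi> permutes {1..n}}" by (simp add: finite_permutations)
  moreover have "{\<pi>. \<pi> permutes {1..n}} \<noteq> {}" using permutes_id by blast
  ultimately show ?thesis
    unfolding correlated_law_def by (simp add: finite_set_bernoulli_field)
qed

lemma expectation_correlated_centered:
  assumes p: "0 \<le> p" "p \<le> 1" and s: "0 \<le> s" "s \<le> 1"
    and X: "X \<subseteq> edge_slots n <+> edge_slots n"
  shows "measure_pmf.expectation (correlated_law n p s) (centered (p * s) X) =
         (p * s\<^sup>2 * (1 - p)) ^ card (Inl -` X) * match_prob n (Inl -` X) (Inr -` X)"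
proof -
  define P where "P = {\<pi>. \<pi> permutes {1..n}}"
  let ?a = "(p * s\<^sup>2 * (1 - p)) ^ card (Inl -` X)"
  have "finite P" by (simp add: P_def finite_permutations)
  have "measure_pmf.expectation (correlated_law n p s) (centered (p * s) X) =
      (\<Sum>\<pi>\<in>P. if (`) \<pi> ` (Inl -` X) = Inr -` X then ?a else 0) / fact n"
    unfolding expectation_correlated_law P_def
    by (intro arg_cong2[where f = "(/)"] sum.cong refl
        expectation_correlated_centered_given_permutation[OF p s X]) simp
  also have "\<dots> = ?a * match_prob n (Inl -` X) (Inr -` X)"
    using \<open>finite P\<close> by (simp add: sum.If_cases match_prob_def P_def Int_def)
  finally show ?thesis .
qed

section \<open>Counting edge sets up to isomorphism\<close>

lemma match_prob_nonneg: "0 \<le> match_prob n S T"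
  by (simp add: match_prob_def)

lemma finite_permutes_interval: "finite {\<pi>. \<pi> permutes {1..n::nat} \<and> Q \<pi>}"
  by (rule finite_subset[OF _ finite_permutations[of "{1..n}"]]) auto

lemma image_edges_card:
  assumes "\<pi> permutes {1..n}"
  shows "card ((`) \<pi> ` S) = card S"
  by (rule card_image) (use permutes_inj[OF assms] in \<open>auto simp: inj_on_def inj_image_eq_iff\<close>)

text \<open>Relabelling preserves the number of edges. This removes every index set whose two parts
  differ in size.\<close>

lemma match_prob_eq_0: "card S \<noteq> card T \<Longrightarrow> match_prob n S T = 0"
  using image_edges_card[of _ n S] unfolding match_prob_def
  by (metis (mono_tags, lifting) card.empty div_0 empty_Collect_eq of_nat_0)

lemma image_edges_inv:
  assumes "\<pi> permutes {1..n}"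
  shows "(`) (inv \<pi>) ` (`) \<pi> ` S = S"
  by (simp add: image_image permutes_inverses[OF assms])

text \<open>The permutations carrying \<open>S\<close> to \<open>T\<close> form the left coset of
  the stabiliser of \<open>S\<close> through \<tau>, and composition with \<tau> is the bijection
  between the two.\<close>

lemma match_prob_eq_self:
  assumes \<tau>: "\<tau> permutes {1..n}" "(`) \<tau> ` S = T"
  shows "match_prob n S T = match_prob n S S"
proof -
  have TS: "(`) (inv \<tau>) ` T = S"
    using \<tau> image_edges_inv by blast
  have "bij_betw ((\<circ>) \<tau>) {\<pi>. \<pi> permutes {1..n} \<and> (`) \<pi> ` S = S}
      {\<pi>. \<pi> permutes {1..n} \<and> (`) \<pi> ` S = T}"
  proof (rule bij_betwI[where g = "(\<circ>) (inv \<tau>)"])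
    show "(\<circ>) \<tau> \<in> {\<pi>. \<pi> permutes {1..n} \<and> (`) \<pi> ` S = S} \<rightarrow>
        {\<pi>. \<pi> permutes {1..n} \<and> (`) \<pi> ` S = T}"
    proof
      fix \<pi> assume "\<pi> \<in> {\<pi>. \<pi> permutes {1..n} \<and> (`) \<pi> ` S = S}"
      then have "\<pi> permutes {1..n}" "(`) \<pi> ` S = S" by auto
      moreover have "(`) (\<tau> \<circ> \<pi>) ` S = (`) \<tau> ` (`) \<pi> ` S" by (simp add: image_image image_comp)
      ultimately show "\<tau> \<circ> \<pi> \<in> {\<pi>. \<pi> permutes {1..n} \<and> (`) \<pi> ` S = T}"
        using \<tau> permutes_compose by auto
    qed
    show "(\<circ>) (inv \<tau>) \<in> {\<pi>. \<pi> permutes {1..n} \<and> (`) \<pi> ` S = T} \<rightarrow>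
        {\<pi>. \<pi> permutes {1..n} \<and> (`) \<pi> ` S = S}"
    proof
      fix \<pi> assume "\<pi> \<in> {\<pi>. \<pi> permutes {1..n} \<and> (`) \<pi> ` S = T}"
      then have "\<pi> permutes {1..n}" "(`) \<pi> ` S = T" by auto
      moreover have "(`) (inv \<tau> \<circ> \<pi>) ` S = (`) (inv \<tau>) ` (`) \<pi> ` S"
        by (simp add: image_image image_comp)
      ultimately show "inv \<tau> \<circ> \<pi> \<in> {\<pi>. \<pi> permutes {1..n} \<and> (`) \<pi> ` S = S}"
        using permutes_inv[OF \<tau>(1)] TS permutes_compose by auto
    qed
  qed (simp_all add: o_assoc permutes_inv_o[OF \<tau>(1)])
  then show ?thesis by (simp add: match_prob_def bij_betw_same_card)
qed

lemma match_prob_le_self: "match_prob n S T \<le> match_prob n S S"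
proof (cases "\<exists>\<tau>. \<tau> permutes {1..n} \<and> (`) \<tau> ` S = T")
  case True
  then show ?thesis using match_prob_eq_self by fastforce
next
  case False
  then have "match_prob n S T = 0" unfolding match_prob_def
    by (metis (mono_tags, lifting) card.empty div_0 empty_Collect_eq of_nat_0)
  then show ?thesis using match_prob_nonneg[of n S S] by simp
qed

text \<open>The fibres of \<open>h\<close> are disjoint sets of permutations. A general
  \<open>h\<close> covers both the image of an edge set under a permutation and its image under the
  inverse.\<close>

lemma sum_card_permutes_le_fact:
  assumes "finite F"
  shows "(\<Sum>T\<in>F. real (card {\<pi>. \<pi> permutes {1..n::nat} \<and> h \<pi> = T})) \<le> fact n"
proof -
  have "(\<Sum>T\<in>F. card {\<pi>. \<pi> permutes {1..n} \<and> h \<pi> = T}) =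
      card (\<Union>T\<in>F. {\<pi>. \<pi> permutes {1..n} \<and> h \<pi> = T})"
    by (intro card_UN_disjoint[symmetric] ballI assms finite_permutes_interval) auto
  also have "\<dots> \<le> card {\<pi>. \<pi> permutes {1..n}}"
    by (intro card_mono) (auto simp: finite_permutations)
  also have "\<dots> = fact n" by (simp add: card_permutations)
  finally show ?thesis by (metis of_nat_fact of_nat_le_iff of_nat_sum)
qed

lemma sum_match_prob_right_le_1: "finite F \<Longrightarrow> (\<Sum>T\<in>F. match_prob n S T) \<le> 1"
  using sum_card_permutes_le_fact[of F n "\<lambda>\<pi>. (`) \<pi> ` S"]
  by (simp add: match_prob_def sum_divide_distrib[symmetric])

text \<open>If a permutation carries \<open>S\<close> to \<open>T\<close>, then its inverse carries
  \<open>T\<close> to \<open>S\<close>. For fixed \<open>T\<close> the events are therefore disjoint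
  as \<open>S\<close> varies.\<close>

lemma sum_match_prob_left_le_1:
  assumes "finite F"
  shows "(\<Sum>S\<in>F. match_prob n S T) \<le> 1"
proof -
  have "{\<pi>. \<pi> permutes {1..n} \<and> (`) \<pi> ` S = T} \<subseteq>
      {\<pi>. \<pi> permutes {1..n} \<and> (`) (inv \<pi>) ` T = S}" for S
    using image_edges_inv by blast
  then have "(\<Sum>S\<in>F. match_prob n S T) \<le>
      (\<Sum>S\<in>F. real (card {\<pi>. \<pi> permutes {1..n} \<and> (`) (inv \<pi>) ` T = S}) / fact n)"
    unfolding match_prob_def
    by (intro sum_mono divide_right_mono of_nat_mono card_mono finite_permutes_interval) auto
  also have "\<dots> \<le> 1"
    using sum_card_permutes_le_fact[OF assms, of n "\<lambda>\<pi>. (`) (inv \<pi>) ` T"]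
    by (simp add: sum_divide_distrib[symmetric])
  finally show ?thesis .
qed

section \<open>Orbit representatives on few vertices and their number\<close>

lemma ex_permutes_into_initial_interval:
  assumes "V \<subseteq> {1..n}"
  shows "\<exists>\<pi>. \<pi> permutes {1..n} \<and> \<pi> ` V = {1..card V}"
proof -
  have fin: "finite V" using assms finite_subset by blast
  have le: "card V \<le> n" using card_mono[OF _ assms] by simp
  then have sub: "{1..card V} \<subseteq> {1..n}" by auto
  obtain f where f: "bij_betw f V {1..card V}"
    using finite_same_card_bij[of V "{1..card V}"] fin by auto
  have "card ({1..n} - V) = card ({1..n} - {1..card V})"
    using assms sub fin by (simp add: card_Diff_subset)
  then obtain g where g: "bij_betw g ({1..n} - V) ({1..n} - {1..card V})"
    using finite_same_card_bij[of "{1..n} - V" "{1..n} - {1..card V}"] by auto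
  \<comment> \<open>The bijections on \<open>V\<close> and on its complement are glued; outside
    \<open>{1..n}\<close> the map is the identity, as \<open>permutes\<close> demands.\<close>
  define \<pi> where "\<pi> x = (if x \<in> V then f x else if x \<in> {1..n} then g x else x)" for x
  have \<pi>V: "bij_betw \<pi> V {1..card V}"
    using f by (subst bij_betw_cong[of _ _ f]) (auto simp: \<pi>_def)
  have "bij_betw \<pi> ({1..n} - V) ({1..n} - {1..card V})"
    using g by (subst bij_betw_cong[of _ _ g]) (auto simp: \<pi>_def)
  with \<pi>V have "bij_betw \<pi> (V \<union> ({1..n} - V)) ({1..card V} \<union> ({1..n} - {1..card V}))"
    by (rule bij_betw_combine) auto
  then have "bij_betw \<pi> {1..n} {1..n}" using assms sub by (simp add: Un_absorb1)
  then have "\<pi> permutes {1..n}"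
    by (rule bij_imp_permutes) (use assms in \<open>auto simp: \<pi>_def\<close>)
  then show ?thesis using \<pi>V by (auto simp: bij_betw_def)
qed

text \<open>The edges of \<open>S\<close> touch at most \<open>2 * card S\<close> vertices, and
  these can be moved to an initial interval. The bound \<open>2 * card S\<close> may exceed
  \<open>n\<close>; the moved edges use only the labels up to
  \<open>card (\<Union>S)\<close>.\<close>

lemma ex_permutes_into_edge_slots_double_card:
  assumes S: "S \<subseteq> edge_slots n"
  shows "\<exists>\<pi>. \<pi> permutes {1..n} \<and> (`) \<pi> ` S \<subseteq> edge_slots (2 * card S)"
proof -
  have finS: "finite S" using S finite_edge_slots finite_subset by blast
  have e2: "card e \<le> 2" "e \<subseteq> {1..n}" if "e \<in> S" for e
    using S that by (auto simp: edge_slots_def card_insert_if)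
  have "card (\<Union>S) \<le> (\<Sum>e\<in>S. card e)" using card_Union_le_sum_card .
  also have "\<dots> \<le> 2 * card S" using sum_bounded_above[of S card 2] e2 by (simp add: mult.commute)
  finally have cardV: "card (\<Union>S) \<le> 2 * card S" .
  obtain \<pi> where \<pi>: "\<pi> permutes {1..n}" "\<pi> ` \<Union>S = {1..card (\<Union>S)}"
    using ex_permutes_into_initial_interval[of "\<Union>S" n] e2 by (meson Union_least)
  have "(`) \<pi> ` S \<subseteq> edge_slots (2 * card S)"
  proof
    fix x assume "x \<in> (`) \<pi> ` S"
    then obtain e where e: "e \<in> S" "x = \<pi> ` e" by auto
    then obtain i j where ij: "e = {i, j}" "i \<noteq> j" using S by (auto simp: edge_slots_def)
    have "\<pi> i \<in> {1..card (\<Union>S)}" "\<pi> j \<in> {1..card (\<Union>S)}"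
      using e ij \<pi>(2) by blast+
    moreover have "\<pi> i \<noteq> \<pi> j" using permutes_inj[OF \<pi>(1)] ij by (auto dest: injD)
    moreover have "x = {\<pi> i, \<pi> j}" using e ij by simp
    ultimately show "x \<in> edge_slots (2 * card S)"
      using cardV by (force simp: edge_slots_def)
  qed
  then show ?thesis using \<pi> by blast
qed

lemma card_edge_slots_le: "card (edge_slots m) \<le> m\<^sup>2"
proof -
  have "edge_slots m \<subseteq> (\<lambda>(i, j). {i, j}) ` ({1..m} \<times> {1..m})"
    by (auto simp: edge_slots_def)
  then have "card (edge_slots m) \<le> card ({1..m} \<times> {1..m})"
    by (intro surj_card_le) auto
  then show ?thesis by (simp add: power2_eq_square)
qed

definition edge_sets :: "nat \<Rightarrow> nat \<Rightarrow> nat set set set" where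
  "edge_sets n k = {S. S \<subseteq> edge_slots n \<and> card S = k}"

lemma finite_edge_sets: "finite (edge_sets n k)"
  by (rule finite_subset[of _ "Pow (edge_slots n)"]) (auto simp: edge_sets_def finite_edge_slots)

text \<open>With N the number of edge slots, (N choose k) * k! is at most N^k, and N is at most
  (2k)^2. Keeping the factor 1 / k! is what later produces an exponential series.\<close>

lemma card_edge_sets_double_le: "real (card (edge_sets (2 * k) k)) \<le> real ((2 * k) ^ (2 * k)) / fact k"
proof -
  have "card (edge_sets (2 * k) k) * fact k = (card (edge_slots (2 * k)) choose k) * fact k"
    by (simp add: edge_sets_def n_subsets finite_edge_slots)
  also have "\<dots> \<le> card (edge_slots (2 * k)) ^ k" by (rule binomial_fact_pow)
  also have "\<dots> \<le> ((2 * k)\<^sup>2) ^ k" by (intro power_mono card_edge_slots_le) simp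
  also have "\<dots> = (2 * k) ^ (2 * k)" by (simp only: power_mult)
  finally have "real (card (edge_sets (2 * k) k) * fact k) \<le> real ((2 * k) ^ (2 * k))"
    by (rule of_nat_mono)
  then show ?thesis by (simp add: pos_le_divide_eq)
qed

text \<open>The left-hand side is the number of orbits of \<open>k\<close>-edge graphs under relabelling, and every
  orbit has a representative supported on the first \<open>2 * k\<close> vertices.\<close>

lemma sum_match_prob_square_le:
  "(\<Sum>S\<in>edge_sets n k. \<Sum>T\<in>edge_sets n k. (match_prob n S T)\<^sup>2) \<le> real (card (edge_sets (2 * k) k))"
proof -
  let ?R = "edge_sets (2 * k) k"
  \<comment> \<open>For fixed \<open>S\<close>, the largest matching probability is
    \<open>match_prob n S S\<close> and the probabilities sum to at most 1, so the sum of squares is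
    at most \<open>match_prob n S S\<close>. This equals the probability of hitting the
    representative of \<open>S\<close> in \<open>?R\<close>.\<close>
  have "(\<Sum>T\<in>edge_sets n k. (match_prob n S T)\<^sup>2) \<le> (\<Sum>T\<in>?R. match_prob n S T)"
    if S: "S \<in> edge_sets n k" for S
  proof -
    have "(\<Sum>T\<in>edge_sets n k. (match_prob n S T)\<^sup>2) \<le>
        (\<Sum>T\<in>edge_sets n k. match_prob n S S * match_prob n S T)"
      unfolding power2_eq_square
      by (intro sum_mono mult_right_mono match_prob_le_self match_prob_nonneg)
    also have "\<dots> \<le> match_prob n S S"
      using mult_left_mono[OF sum_match_prob_right_le_1[OF finite_edge_sets, of n S n k]
          match_prob_nonneg[of n S S]]
      by (simp add: sum_distrib_left)
    also have "\<dots> \<le> (\<Sum>T\<in>?R. match_prob n S T)"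
    proof -
      obtain \<pi> where \<pi>: "\<pi> permutes {1..n}" "(`) \<pi> ` S \<subseteq> edge_slots (2 * k)"
        using ex_permutes_into_edge_slots_double_card[of S n] S by (auto simp: edge_sets_def)
      have "(`) \<pi> ` S \<in> ?R"
        using \<pi> S image_edges_card[OF \<pi>(1), of S] by (auto simp: edge_sets_def)
      then have "match_prob n S ((`) \<pi> ` S) \<le> (\<Sum>T\<in>?R. match_prob n S T)"
        by (intro member_le_sum) (auto simp: match_prob_nonneg finite_edge_sets)
      then show ?thesis using match_prob_eq_self[OF \<pi>(1) refl] by simp
    qed
    finally show ?thesis .
  qed
  then have "(\<Sum>S\<in>edge_sets n k. \<Sum>T\<in>edge_sets n k. (match_prob n S T)\<^sup>2) \<le>
      (\<Sum>S\<in>edge_sets n k. \<Sum>T\<in>?R. match_prob n S T)"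
    by (rule sum_mono)
  \<comment> \<open>After the exchange, each representative collects total mass at most 1 from all
    \<open>S\<close>, so the bound counts the elements of \<open>?R\<close>.\<close>
  also have "\<dots> = (\<Sum>T\<in>?R. \<Sum>S\<in>edge_sets n k. match_prob n S T)" by (rule sum.swap)
  also have "\<dots> \<le> (\<Sum>T\<in>?R. 1)"
    by (intro sum_mono sum_match_prob_left_le_1 finite_edge_sets)
  finally show ?thesis by simp
qed

section \<open>The low-degree advantage\<close>

lemma card_index_set:
  assumes "finite X"
  shows "card X = card (Inl -` X) + card (Inr -` X)"
proof -
  have "X = (Inl -` X) <+> (Inr -` X)"
  proof (rule set_eqI)
    fix v show "v \<in> X \<longleftrightarrow> v \<in> (Inl -` X) <+> (Inr -` X)" by (cases v) auto
  qed
  moreover have "finite (Inl -` X)" "finite (Inr -` X)"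
    using assms by (auto intro: finite_vimageI)
  ultimately show ?thesis by (metis card_Plus)
qed

lemma sum_index_sets_match_prob_le:
  fixes r :: real
  assumes r: "0 \<le> r" "real d * r \<le> C"
  shows "(\<Sum>X\<in>index_sets n d. (r ^ card (Inl -` X) * match_prob n (Inl -` X) (Inr -` X))\<^sup>2)
    \<le> exp (C\<^sup>2)"
proof -
  define F where "F = (\<lambda>(S, T). (r ^ card S * match_prob n S T)\<^sup>2)"
  define parts where "parts = (\<lambda>X :: (nat set + nat set) set. (Inl -` X, Inr -` X))"
  \<comment> \<open>Only index sets with parts of equal size contribute. Recording that size as an
    extra component below groups the terms by \<open>k\<close>.\<close>
  define bal where "bal = {X \<in> index_sets n d. card (Inl -` X) = card (Inr -` X)}"
  have inj: "inj_on (\<lambda>X. (card (Inl -` X), parts X)) bal"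
  proof (rule inj_onI)
    fix X Y assume "(card (Inl -` X), parts X) = (card (Inl -` Y), parts Y)"
    then have "Inl -` X = Inl -` Y" "Inr -` X = Inr -` Y" by (auto simp: parts_def)
    then show "X = Y" by (intro set_eqI) (metis sum.exhaust vimage_eq)
  qed
  have "(\<Sum>X\<in>index_sets n d. (r ^ card (Inl -` X) * match_prob n (Inl -` X) (Inr -` X))\<^sup>2) =
      (\<Sum>X\<in>bal. F (parts X))"
    by (rule sum.mono_neutral_cong_right)
       (auto simp: finite_index_sets bal_def F_def parts_def match_prob_eq_0)
  also have "\<dots> = (\<Sum>(k, ST)\<in>(\<lambda>X. (card (Inl -` X), parts X)) ` bal. F ST)"
    by (subst sum.reindex[OF inj]) simp
  \<comment> \<open>Two parts of size \<open>k\<close> give \<open>card X = 2 * k\<close>, so the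
    degree bound becomes \<open>k\<close> at most \<open>d div 2\<close>. The added terms are
    squares.\<close>
  also have "\<dots> \<le> (\<Sum>(k, ST)\<in>Sigma {..d div 2} (\<lambda>k. edge_sets n k \<times> edge_sets n k). F ST)"
  proof (rule sum_mono2)
    show "(\<lambda>X. (card (Inl -` X), parts X)) ` bal \<subseteq>
        Sigma {..d div 2} (\<lambda>k. edge_sets n k \<times> edge_sets n k)"
    proof (rule image_subsetI)
      fix X assume X: "X \<in> bal"
      then have "finite X" by (auto simp: bal_def intro: finite_in_index_sets)
      then have "card X = card (Inl -` X) + card (Inr -` X)" by (rule card_index_set)
      then show "(card (Inl -` X), parts X) \<in> Sigma {..d div 2} (\<lambda>k. edge_sets n k \<times> edge_sets n k)"
        using X by (auto simp: bal_def parts_def edge_sets_def index_sets_def)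
    qed
  qed (auto simp: F_def finite_edge_sets)
  also have "\<dots> = (\<Sum>k\<le>d div 2. \<Sum>(S, T)\<in>edge_sets n k \<times> edge_sets n k. F (S, T))"
    by (subst sum.Sigma[symmetric]) (auto simp: finite_edge_sets)
  also have "\<dots> = (\<Sum>k\<le>d div 2. r ^ (2 * k) *
      (\<Sum>S\<in>edge_sets n k. \<Sum>T\<in>edge_sets n k. (match_prob n S T)\<^sup>2))"
    unfolding sum.cartesian_product[symmetric] sum_distrib_left
    by (intro sum.cong refl)
       (auto simp: F_def edge_sets_def power_mult_distrib power_mult[symmetric] mult.commute)
  also have "\<dots> \<le> (\<Sum>k\<le>d div 2. r ^ (2 * k) * (real ((2 * k) ^ (2 * k)) / fact k))"
    using r by (intro sum_mono mult_left_mono order_trans[OF sum_match_prob_square_le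
          card_edge_sets_double_le]) auto
  \<comment> \<open>The degree condition enters here: (2k) r is at most d r, hence at most C, so the
    factor (2k)^(2k) is absorbed by r^(2k). What remains is a partial sum of the series of
    \<open>exp\<close> at C^2.\<close>
  also have "\<dots> \<le> (\<Sum>k\<le>d div 2. (C\<^sup>2) ^ k /\<^sub>R fact k)"
  proof (rule sum_mono)
    fix k assume "k \<in> {..d div 2}"
    then have "real (2 * k) \<le> real d" by auto
    then have "real (2 * k) * r \<le> C" using r mult_right_mono[of "real (2 * k)" "real d" r] by linarith
    then have "(real (2 * k) * r) ^ (2 * k) \<le> C ^ (2 * k)" using r by (intro power_mono) auto
    then have "(real (2 * k) * r) ^ (2 * k) / fact k \<le> C ^ (2 * k) / fact k"
      by (intro divide_right_mono) auto
    then show "r ^ (2 * k) * (real ((2 * k) ^ (2 * k)) / fact k) \<le> (C\<^sup>2) ^ k /\<^sub>R fact k"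
      by (simp add: power_mult_distrib power_mult[symmetric] field_simps)
  qed
  also have "\<dots> \<le> exp (C\<^sup>2)"
    unfolding exp_def
    by (intro sum_le_suminf summable_exp_generic) auto
  finally show ?thesis .
qed

lemma expectation_correlated_le:
  fixes p s \<rho> C :: real
  defines "q \<equiv> p * s"
  assumes p: "0 < p" "p < 1" and s: "0 < s" "s < 1"
    and \<rho>: "\<rho> = s * (1 - p) / (1 - p * s)" and d: "real d * \<rho> \<le> C"
    and f: "f \<in> poly_functions n d"
  shows "measure_pmf.expectation (correlated_law n p s) f \<le>
    sqrt (measure_pmf.expectation (independent_law n q) (\<lambda>G. (f G)\<^sup>2)) * sqrt (exp (C\<^sup>2))"
proof -
  have "p * s < 1" using p s mult_strict_mono[of p 1 s 1] by simp
  then have q: "0 < q" "q < 1" using p s by (auto simp: q_def)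
  define v where "v = q * (1 - q)"
  have v: "0 < v" using q by (simp add: v_def)
  have \<rho>0: "0 \<le> \<rho>" using p s \<open>p * s < 1\<close> by (simp add: \<rho>)
  \<comment> \<open>The covariance on a matched edge is the correlation \<rho> times the variance
    \<open>v\<close>.\<close>
  have \<rho>v: "p * s\<^sup>2 * (1 - p) = \<rho> * v"
    using \<open>p * s < 1\<close> by (simp add: \<rho> v_def q_def power2_eq_square field_simps)
  have "f \<in> centered_span n q d" using f poly_functions_subset_centered_span by blast
  then obtain c where c: "f = (\<lambda>G. \<Sum>X\<in>index_sets n d. c X * centered q X G)"
    unfolding centered_span_def by blast
  let ?L = "index_sets n d"
  let ?a = "\<lambda>X. \<rho> ^ card (Inl -` X) * match_prob n (Inl -` X) (Inr -` X)"
  have sub: "X \<subseteq> edge_slots n <+> edge_slots n" if "X \<in> ?L" for X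
    using that by (simp add: index_sets_def)
  \<comment> \<open>Parseval's identity: \<open>c X * sqrt v ^ card X\<close> is the coefficient of
    \<open>f\<close> in the normalised basis.\<close>
  have second_moment: "measure_pmf.expectation (independent_law n q) (\<lambda>G. (f G)\<^sup>2) =
      (\<Sum>X\<in>?L. (c X * sqrt v ^ card X)\<^sup>2)"
  proof -
    have "measure_pmf.expectation (independent_law n q) (\<lambda>G. (f G)\<^sup>2) =
      measure_pmf.expectation (independent_law n q)
        (\<lambda>G. \<Sum>X\<in>?L. \<Sum>Y\<in>?L. c X * c Y * (centered q X G * centered q Y G))"
      by (simp add: c power2_eq_square sum_product mult_ac)
    also have "\<dots> = (\<Sum>X\<in>?L. \<Sum>Y\<in>?L. c X * c Y *
        measure_pmf.expectation (independent_law n q) (\<lambda>G. centered q X G * centered q Y G))"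
      by (simp add: Bochner_Integration.integral_sum integrable_measure_pmf_finite
          finite_set_independent_law)
    also have "\<dots> = (\<Sum>X\<in>?L. \<Sum>Y\<in>?L. if X = Y then c X * c Y * v ^ card X else 0)"
      using q by (intro sum.cong refl)
        (simp add: expectation_independent_centered_mult sub v_def)
    also have "\<dots> = (\<Sum>X\<in>?L. (c X * sqrt v ^ card X)\<^sup>2)"
      using v by (intro sum.cong refl)
        (simp add: finite_index_sets power_mult_distrib power2_eq_square[of "c _"]
          power_mult[symmetric] mult.commute[of _ 2], simp add: power_mult)
    finally show ?thesis .
  qed
  have "measure_pmf.expectation (correlated_law n p s) f =
      (\<Sum>X\<in>?L. c X * measure_pmf.expectation (correlated_law n p s) (centered q X))"
    by (simp add: c Bochner_Integration.integral_sum integrable_measure_pmf_finite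
        finite_set_correlated_law)
  also have "\<dots> = (\<Sum>X\<in>?L. (c X * sqrt v ^ card X) * ?a X)"
  proof (rule sum.cong[OF refl])
    fix X assume X: "X \<in> ?L"
    have "measure_pmf.expectation (correlated_law n p s) (centered q X) =
        (\<rho> * v) ^ card (Inl -` X) * match_prob n (Inl -` X) (Inr -` X)"
      unfolding q_def \<rho>v[symmetric] using p s sub[OF X]
      by (intro expectation_correlated_centered) auto
    \<comment> \<open>If both parts have equal size, \<open>card X\<close> is twice that size and
      the powers of \<open>v\<close> agree. Otherwise both sides vanish with
      \<open>match_prob\<close>.\<close>
    also have "\<dots> = sqrt v ^ card X * ?a X"
    proof (cases "card (Inl -` X) = card (Inr -` X)")
      case True
      then have "card X = 2 * card (Inl -` X)"
        using card_index_set[OF finite_in_index_sets[OF X]] by simp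
      then have "sqrt v ^ card X = v ^ card (Inl -` X)" using v by (simp add: power_mult)
      then show ?thesis by (simp add: power_mult_distrib)
    qed (simp add: match_prob_eq_0)
    finally show "c X * measure_pmf.expectation (correlated_law n p s) (centered q X) =
      (c X * sqrt v ^ card X) * ?a X" by simp
  qed
  \<comment> \<open>Cauchy-Schwarz, after bounding each product by the product of absolute
    values.\<close>
  also have "\<dots> \<le> L2_set (\<lambda>X. c X * sqrt v ^ card X) ?L * L2_set ?a ?L"
    by (rule order_trans[OF sum_mono L2_set_mult_ineq]) (metis abs_ge_self abs_mult)
  also have "\<dots> \<le> sqrt (measure_pmf.expectation (independent_law n q) (\<lambda>G. (f G)\<^sup>2)) * sqrt (exp (C\<^sup>2))"
    unfolding L2_set_def second_moment
    by (intro mult_left_mono real_sqrt_le_mono sum_index_sets_match_prob_le \<rho>0 d)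
       (simp add: sum_nonneg)
  finally show ?thesis .
qed

theorem mainTheorem1:
  "\<forall>C::real. C > 0 \<longrightarrow> (\<exists>C'::real.
     \<forall>(n::nat) (p::real) (s::real) (q::real) (\<rho>::real) (d::nat).
       n \<ge> 1 \<longrightarrow> p \<in> {0<..<1} \<longrightarrow> s \<in> {0<..<1} \<longrightarrow>
       q = p * s \<longrightarrow> \<rho> = s * (1 - p) / (1 - p * s) \<longrightarrow>
       1 \<le> d \<longrightarrow> real d \<le> C * inverse \<rho> \<longrightarrow>
       (SUP f \<in> {f \<in> poly_functions n d.
                   measure_pmf.expectation (independent_law n q) (\<lambda>G. (f G)\<^sup>2) > 0}.
          ereal (measure_pmf.expectation (correlated_law n p s) f /
                 sqrt (measure_pmf.expectation (independent_law n q) (\<lambda>G. (f G)\<^sup>2))))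
       \<le> ereal C')"
proof (intro allI impI, rule exI, intro allI impI SUP_least)
  fix C p s q \<rho> :: real and n d :: nat and f
  assume p: "p \<in> {0<..<1}" and s: "s \<in> {0<..<1}" and q: "q = p * s"
    and \<rho>: "\<rho> = s * (1 - p) / (1 - p * s)" and d: "real d \<le> C * inverse \<rho>"
    and f: "f \<in> {f \<in> poly_functions n d.
      measure_pmf.expectation (independent_law n q) (\<lambda>G. (f G)\<^sup>2) > 0}"
  have "p * s < 1" using p s mult_strict_mono[of p 1 s 1] by simp
  then have "0 < \<rho>" using p s by (simp add: \<rho>)
  then have "real d * \<rho> \<le> C" using d by (simp add: field_simps)
  then have "measure_pmf.expectation (correlated_law n p s) f \<le>
    sqrt (measure_pmf.expectation (independent_law n q) (\<lambda>G. (f G)\<^sup>2)) * sqrt (exp (C\<^sup>2))"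
    using p s \<rho> f unfolding q by (intro expectation_correlated_le) auto
  \<comment> \<open>This fixes the witness for C', left open by \<open>exI\<close>, as
    \<open>sqrt (exp (C\<^sup>2))\<close>, which depends on C alone.\<close>
  then show "ereal (measure_pmf.expectation (correlated_law n p s) f /
      sqrt (measure_pmf.expectation (independent_law n q) (\<lambda>G. (f G)\<^sup>2)))
    \<le> ereal (sqrt (exp (C\<^sup>2)))"
    using f by (simp add: pos_divide_le_eq mult.commute)
qed

end
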